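(* Let $p\equiv 3\pmod 4$ be a prime. For an integer $k$, let $R(k,p)$ be the unique $r\in\{0,1,\dots,\frac{p-1}{2}\}$ such that $k\equiv r\pmod p$ or $k\equiv -r\pmod p$. Define $$N_p=\#\left\{(i,j):\ 1\le i<j\le \tfrac{p-1}{2}\ \text{and}\ R(i^2,p)>R(j^2,p)\right\}.$$ Then $N_p\equiv\left\lfloor\frac{p+1}{8}\right\rfloor\pmod 2$.
   Context: $\#S$ denotes the cardinality of a finite set $S$ and $\lfloor\cdot\rfloor$ the floor function. *)

theory Defs
  imports Complex_Main "HOL-Number_Theory.Number_Theory"
begin

definition R :: "int \<Rightarrow> nat \<Rightarrow> nat" where
  "R k p = (THE r. r \<in> {0..(p - 1) div 2} \<and>
     ([k = int r] (mod int p) \<or> [k = - int r] (mod int p)))"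

lemma R_ex1:
  fixes k :: int and p :: nat
  assumes "odd p"
  shows "\<exists>!r. r \<in> {0..(p - 1) div 2} \<and>
     ([k = int r] (mod int p) \<or> [k = - int r] (mod int p))"
proof -
  from assms obtain m where m: "p = 2 * m + 1" by (elim oddE)
  define s where "s = k mod int p"
  have s: "0 \<le> s" "s < int p" "[k = s] (mod int p)"
    using m by (simp_all add: s_def cong_def)
  have ex: "\<exists>r. r \<in> {0..(p - 1) div 2} \<and>
     ([k = int r] (mod int p) \<or> [k = - int r] (mod int p))"
  proof (cases "s \<le> int m")
    case True
    with s m show ?thesis by (intro exI[of _ "nat s"]) auto
  next
    case False
    have "[s = s - int p] (mod int p)" by (simp add: cong_def)
    with s have "[k = s - int p] (mod int p)" using cong_trans by blast
    with s m False show ?thesis by (intro exI[of _ "nat (int p - s)"]) auto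
  qed
  have uniq: "r = r'"
    if r: "r \<in> {0..(p - 1) div 2}" "r' \<in> {0..(p - 1) div 2}"
      and c: "[k = int r] (mod int p) \<or> [k = - int r] (mod int p)"
        "[k = int r'] (mod int p) \<or> [k = - int r'] (mod int p)" for r r'
  proof -
    have "[int r = int r'] (mod int p) \<or> [int r = - int r'] (mod int p)
        \<or> [- int r = int r'] (mod int p) \<or> [- int r = - int r'] (mod int p)"
      using c by (meson cong_sym cong_trans)
    then have "int p dvd int r - int r' \<or> int p dvd int r + int r'"
      by (auto simp: cong_iff_dvd_diff dvd_diff_commute)
         (metis add.commute dvd_minus_iff minus_add_distrib uminus_add_conv_diff)
    moreover have "\<bar>int r - int r'\<bar> < int p" "\<bar>int r + int r'\<bar> < int p"
      using r m by auto
    ultimately have "int r - int r' = 0 \<or> int r + int r' = 0"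
      using zdvd_not_zless dvd_imp_le_int by (metis abs_of_nat not_le)
    then show ?thesis by auto
  qed
  show ?thesis using ex uniq by blast
qed

definition N :: "nat \<Rightarrow> nat" where
  "N p = card {(i::nat, j::nat). 1 \<le> i \<and> i < j \<and> j \<le> (p - 1) div 2 \<and>
     R (int i ^ 2) p > R (int j ^ 2) p}"

end

theory Submission
  imports Defs
begin

text \<open>
  The residues \<open>R k p\<close> with \<open>p\<close> not dividing \<open>k\<close> represent the nonzero residues modulo \<open>p\<close> up to
  sign, which form a cyclic group of order \<open>n = (p - 1) / 2\<close>; for \<open>p \<equiv> 3 (mod 4)\<close> this order is
  odd, so squaring permutes the group. The parity of the number of inversions is multiplicative
  under composition of bijections between finite linearly ordered sets, hence invariant under
  conjugation. A primitive root conjugates squaring to doubling modulo \<open>n = 2 m + 1\<close>, whose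
  inversions can be counted directly: there are \<open>m (m + 1) / 2\<close> of them.
\<close>

definition increasing_pairs :: "'a::linorder set \<Rightarrow> ('a \<times> 'a) set" where
  "increasing_pairs A = {(i, j). i \<in> A \<and> j \<in> A \<and> i < j}"

definition inversions :: "('a::linorder \<Rightarrow> 'b::linorder) \<Rightarrow> 'a set \<Rightarrow> ('a \<times> 'a) set" where
  "inversions f A = {(i, j) \<in> increasing_pairs A. f i > f j}"

definition inversion_sign :: "('a::linorder \<Rightarrow> 'b::linorder) \<Rightarrow> 'a set \<Rightarrow> int" where
  "inversion_sign f A = (- 1) ^ card (inversions f A)"

definition order_sign :: "('a::linorder \<Rightarrow> 'b::linorder) \<Rightarrow> 'a \<Rightarrow> 'a \<Rightarrow> int" where
  "order_sign f i j = (if i > j \<longleftrightarrow> f i > f j then 1 else - 1)"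

lemma finite_increasing_pairs:
  assumes "finite A"
  shows "finite (increasing_pairs A)"
  by (rule finite_subset[of _ "A \<times> A"]) (use assms in \<open>auto simp: increasing_pairs_def\<close>)

lemma bij_betw_increasing_pairs:
  assumes "bij_betw f A B"
  shows "bij_betw (\<lambda>(i, j). (min (f i) (f j), max (f i) (f j)))
    (increasing_pairs A) (increasing_pairs B)"
proof -
  define f' where "f' = inv_into A f"
  have f: "f i \<in> B" "f' (f i) = i" if "i \<in> A" for i
    using that assms by (auto simp: f'_def bij_betw_apply bij_betw_inv_into_left)
  have f': "f' i \<in> A" "f (f' i) = i" if "i \<in> B" for i
    using that assms
    by (auto simp: f'_def bij_betw_inv_into_right bij_betw_apply[OF bij_betw_inv_into])
  have f_eq: "f i = f j \<longleftrightarrow> i = j" if "i \<in> A" "j \<in> A" for i j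
    using that f by metis
  have f'_eq: "f' i = f' j \<longleftrightarrow> i = j" if "i \<in> B" "j \<in> B" for i j
    using that f' by metis
  show ?thesis
    by (rule bij_betw_byWitness[where f' = "\<lambda>(i, j). (min (f' i) (f' j), max (f' i) (f' j))"])
       (auto simp: increasing_pairs_def min_def max_def f f' f_eq f'_eq not_le less_le
         split: if_splits)
qed

lemma prod_increasing_pairs_reindex:
  fixes F :: "'b::linorder \<Rightarrow> 'b \<Rightarrow> 'c::comm_monoid_mult"
  assumes f: "bij_betw f A B"
    and sym: "\<And>x y. x \<in> B \<Longrightarrow> y \<in> B \<Longrightarrow> F x y = F y x"
  shows "(\<Prod>(i, j) \<in> increasing_pairs A. F (f i) (f j)) = (\<Prod>(x, y) \<in> increasing_pairs B. F x y)"
proof -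
  have "(\<Prod>(i, j) \<in> increasing_pairs A. F (f i) (f j)) =
      (\<Prod>(i, j) \<in> increasing_pairs A. F (min (f i) (f j)) (max (f i) (f j)))"
    by (rule prod.cong)
       (auto simp: increasing_pairs_def min_def max_def sym bij_betw_apply[OF f])
  also have "\<dots> = (\<Prod>(x, y) \<in> increasing_pairs B. F x y)"
    using prod.reindex_bij_betw[OF bij_betw_increasing_pairs[OF f], of "\<lambda>(x, y). F x y"]
    by (simp add: case_prod_unfold)
  finally show ?thesis .
qed

lemma order_sign_commute:
  assumes "inj_on f A" "i \<in> A" "j \<in> A"
  shows "order_sign f i j = order_sign f j i"
  using assms by (cases "i = j") (auto simp: order_sign_def inj_on_eq_iff not_less le_less)

lemma order_sign_comp: "order_sign (g \<circ> f) i j = order_sign f i j * order_sign g (f i) (f j)"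
  by (simp add: order_sign_def)

lemma inversion_sign_eq_prod:
  assumes "finite A"
  shows "inversion_sign f A = (\<Prod>(i, j) \<in> increasing_pairs A. order_sign f i j)"
proof -
  have "increasing_pairs A \<inter> inversions f A = inversions f A"
    by (auto simp: inversions_def)
  then have "inversion_sign f A = (\<Prod>x \<in> increasing_pairs A \<inter> inversions f A. - 1)"
    by (simp add: inversion_sign_def)
  also have "\<dots> = (\<Prod>x \<in> increasing_pairs A. if x \<in> inversions f A then - 1 else 1)"
    using finite_increasing_pairs[OF assms] by (rule prod.inter_restrict)
  also have "\<dots> = (\<Prod>(i, j) \<in> increasing_pairs A. order_sign f i j)"
    by (rule prod.cong) (auto simp: increasing_pairs_def inversions_def order_sign_def split: if_splits)
  finally show ?thesis .
qed

lemma inversion_sign_comp: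
  assumes "finite A" and f: "bij_betw f A B" and g: "inj_on g B"
  shows "inversion_sign (g \<circ> f) A = inversion_sign f A * inversion_sign g B"
proof -
  have "finite B"
    using assms bij_betw_finite by blast
  have "inversion_sign (g \<circ> f) A =
      (\<Prod>(i, j) \<in> increasing_pairs A. order_sign f i j * order_sign g (f i) (f j))"
    using \<open>finite A\<close> by (simp only: inversion_sign_eq_prod order_sign_comp)
  also have "\<dots> = inversion_sign f A * (\<Prod>(i, j) \<in> increasing_pairs A. order_sign g (f i) (f j))"
    using \<open>finite A\<close> by (simp add: inversion_sign_eq_prod prod.distrib case_prod_unfold)
  also have "(\<Prod>(i, j) \<in> increasing_pairs A. order_sign g (f i) (f j)) = inversion_sign g B"
    using prod_increasing_pairs_reindex[OF f order_sign_commute[OF g]] \<open>finite B\<close>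
    by (simp add: inversion_sign_eq_prod)
  finally show ?thesis .
qed

lemma inversion_sign_cong:
  assumes "\<And>i. i \<in> A \<Longrightarrow> f i = g i"
  shows "inversion_sign f A = inversion_sign g A"
proof -
  have "inversions f A = inversions g A"
    using assms by (auto simp: inversions_def increasing_pairs_def)
  then show ?thesis
    by (simp add: inversion_sign_def)
qed

lemma inversion_sign_conj:
  assumes "finite A" and h: "bij_betw h A B" and t: "bij_betw t A A"
    and conj: "\<And>x. x \<in> A \<Longrightarrow> s (h x) = h (t x)"
  shows "inversion_sign s B = inversion_sign t A"
proof -
  have "bij_betw (h \<circ> t) A B"
    using t h by (rule bij_betw_trans)
  then have "inj_on (s \<circ> h) A"
    using conj by (auto simp: bij_betw_def inj_on_def)
  then have s: "inj_on s B"
    using h by (auto simp: bij_betw_def dest: inj_on_imageI)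
  have "inversion_sign (s \<circ> h) A = inversion_sign (h \<circ> t) A"
    using conj by (intro inversion_sign_cong) simp
  then have "inversion_sign h A * inversion_sign s B = inversion_sign t A * inversion_sign h A"
    using h t s \<open>finite A\<close> by (simp add: inversion_sign_comp bij_betw_imp_inj_on)
  then show ?thesis
    by (simp add: inversion_sign_def)
qed

lemma inversion_sign_eq_iff:
  "inversion_sign f A = inversion_sign g B \<longleftrightarrow>
    (even (card (inversions f A)) \<longleftrightarrow> even (card (inversions g B)))"
  by (simp add: inversion_sign_def minus_one_power_iff)

lemma bij_betw_mult_mod:
  fixes a n :: nat
  assumes "coprime a n"
  shows "bij_betw (\<lambda>k. a * k mod n) {..<n} {..<n}"
proof -
  have "inj_on (\<lambda>k. a * k mod n) {..<n}"
    using cong_mult_lcancel_nat[OF assms] by (auto intro!: inj_onI simp: cong_def)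
  moreover have "(\<lambda>k. a * k mod n) ` {..<n} \<subseteq> {..<n}"
    by auto
  ultimately show ?thesis
    by (simp add: bij_betw_def endo_inj_surj)
qed

lemma double_mod_odd:
  fixes k m :: nat
  assumes "k < 2 * m + 1"
  shows "2 * k mod (2 * m + 1) = (if k \<le> m then 2 * k else 2 * k - (2 * m + 1))"
  using assms by (auto simp: mod_if)

lemma inversions_double_mod_odd:
  fixes m :: nat
  shows "inversions (\<lambda>k. 2 * k mod (2 * m + 1)) {..<2 * m + 1} =
    (\<lambda>(i, c). (i, m + 1 + c)) ` (SIGMA i:{..m}. {..<i})"
    (is "?inversions = ?shift ` ?S")
proof (intro equalityI subsetI)
  fix x
  assume "x \<in> ?inversions"
  then obtain i j where x: "x = (i, j)" and bounds: "i < 2 * m + 1" "j < 2 * m + 1" and "i < j"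
    and "2 * i mod (2 * m + 1) > 2 * j mod (2 * m + 1)"
    by (auto simp: inversions_def increasing_pairs_def)
  then have "i \<le> m" "j > m" "2 * j < 2 * i + (2 * m + 1)"
    unfolding double_mod_odd[OF bounds(1)] double_mod_odd[OF bounds(2)]
    by (auto split: if_splits)
  then have "(i, j - (m + 1)) \<in> ?S" "x = ?shift (i, j - (m + 1))"
    using x by auto
  then show "x \<in> ?shift ` ?S"
    by blast
next
  fix x
  assume "x \<in> ?shift ` ?S"
  then obtain i c where x: "x = (i, m + 1 + c)" and "i \<le> m" "c < i"
    by auto
  then have bounds: "i < 2 * m + 1" "m + 1 + c < 2 * m + 1"
    by auto
  have "2 * i mod (2 * m + 1) > 2 * (m + 1 + c) mod (2 * m + 1)"
    unfolding double_mod_odd[OF bounds(1)] double_mod_odd[OF bounds(2)]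
    using \<open>i \<le> m\<close> \<open>c < i\<close> by auto
  then show "x \<in> ?inversions"
    using x bounds \<open>i \<le> m\<close> by (auto simp: inversions_def increasing_pairs_def)
qed

lemma card_inversions_double_mod_odd:
  fixes m :: nat
  shows "card (inversions (\<lambda>k. 2 * k mod (2 * m + 1)) {..<2 * m + 1}) = m * (m + 1) div 2"
proof -
  have "inj_on (\<lambda>(i, c). (i, m + 1 + c)) (SIGMA i:{..m}. {..<i})"
    by (auto simp: inj_on_def)
  then have "card (inversions (\<lambda>k. 2 * k mod (2 * m + 1)) {..<2 * m + 1}) = (\<Sum>i\<le>m. i)"
    by (simp only: inversions_double_mod_odd card_image) simp
  also have "\<dots> = m * (m + 1) div 2"
    using gauss_sum_nat[of m] by (simp add: atMost_atLeast0)
  finally show ?thesis .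
qed

lemma even_triangular_iff:
  fixes m :: nat
  shows "even (m * (m + 1) div 2) \<longleftrightarrow> even ((m + 1) div 2)"
proof (cases "even m")
  case True
  then obtain k where "m = 2 * k" by (elim evenE)
  then have "m * (m + 1) div 2 = k * (2 * k + 1)" "(m + 1) div 2 = k" by auto
  then show ?thesis by simp
next
  case False
  then obtain k where "m = 2 * k + 1" by (elim oddE)
  then have "m * (m + 1) = 2 * ((2 * k + 1) * (k + 1))" "(m + 1) div 2 = k + 1" by auto
  then show ?thesis by simp
qed

lemma cong_power2_iff_of_prime:
  fixes p k l :: int
  assumes "prime p"
  shows "[k\<^sup>2 = l\<^sup>2] (mod p) \<longleftrightarrow> [k = l] (mod p) \<or> [k = - l] (mod p)"
proof -
  have "k\<^sup>2 - l\<^sup>2 = (k - l) * (k + l)"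
    by (simp add: power2_eq_square algebra_simps)
  then show ?thesis
    using assms by (simp add: cong_iff_dvd_diff prime_dvd_mult_iff)
qed

lemma cong_or_cong_minus_trans:
  fixes a b c m :: int
  assumes "[a = b] (mod m) \<or> [a = - b] (mod m)" "[b = c] (mod m) \<or> [b = - c] (mod m)"
  shows "[a = c] (mod m) \<or> [a = - c] (mod m)"
  using assms by (metis cong_trans cong_minus_minus_iff minus_minus)

lemma R_le:
  assumes "odd p"
  shows "R k p \<le> (p - 1) div 2"
  using theI'[OF R_ex1[OF assms, of k]] unfolding R_def by auto

lemma R_cong:
  assumes "odd p"
  shows "[k = int (R k p)] (mod int p) \<or> [k = - int (R k p)] (mod int p)"
  using theI'[OF R_ex1[OF assms, of k]] unfolding R_def by auto

lemma R_eqI: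
  assumes "odd p" "r \<le> (p - 1) div 2"
    and "[k = int r] (mod int p) \<or> [k = - int r] (mod int p)"
  shows "R k p = r"
  unfolding R_def by (rule the1_equality[OF R_ex1]) (use assms in auto)

lemma R_eq_iff:
  assumes "odd p"
  shows "R k p = R l p \<longleftrightarrow> [k = l] (mod int p) \<or> [k = - l] (mod int p)"
proof
  assume "R k p = R l p"
  moreover have "[int (R l p) = l] (mod int p) \<or> [int (R l p) = - l] (mod int p)"
    using R_cong[OF assms, of l] by (metis cong_sym cong_minus_minus_iff minus_minus)
  ultimately show "[k = l] (mod int p) \<or> [k = - l] (mod int p)"
    using R_cong[OF assms, of k] by (metis cong_or_cong_minus_trans)
next
  assume "[k = l] (mod int p) \<or> [k = - l] (mod int p)"
  then have "[k = int (R l p)] (mod int p) \<or> [k = - int (R l p)] (mod int p)"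
    using R_cong[OF assms] by (rule cong_or_cong_minus_trans)
  then show "R k p = R l p"
    using assms R_le by (intro R_eqI)
qed

lemma R_eq_0_iff:
  assumes "odd p"
  shows "R k p = 0 \<longleftrightarrow> int p dvd k"
proof -
  have "R 0 p = 0"
    using assms by (intro R_eqI) auto
  then show ?thesis
    using R_eq_iff[OF assms, of k 0] by (simp add: cong_iff_dvd_diff)
qed

lemma R_power_R:
  assumes "odd p"
  shows "R (int (R k p) ^ a) p = R (k ^ a) p"
proof -
  have "[k ^ a = int (R k p) ^ a] (mod int p) \<or> [k ^ a = (- int (R k p)) ^ a] (mod int p)"
    using R_cong[OF assms, of k] cong_pow by blast
  then have "R (k ^ a) p = R (int (R k p) ^ a) p"
    using R_eq_iff[OF assms] by (cases "even a") auto
  then show ?thesis ..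
qed

lemma R_primroot_power_eq_iff:
  assumes "prime p" "odd p" "residue_primroot p g"
  shows "R (int g ^ k) p = R (int g ^ l) p \<longleftrightarrow> [k = l] (mod ((p - 1) div 2))"
proof -
  have "coprime p g" and "ord p g = (p - 1) div 2 * 2"
    using assms by (simp_all add: residue_primroot_def totient_prime)
  have "R (int g ^ k) p = R (int g ^ l) p \<longleftrightarrow> [(int g ^ k)\<^sup>2 = (int g ^ l)\<^sup>2] (mod int p)"
    using \<open>prime p\<close> \<open>odd p\<close> by (simp add: R_eq_iff cong_power2_iff_of_prime)
  also have "\<dots> \<longleftrightarrow> [g ^ (k * 2) = g ^ (l * 2)] (mod p)"
    by (simp add: power_mult flip: cong_int_iff)
  also have "\<dots> \<longleftrightarrow> [k * 2 = l * 2] (mod ((p - 1) div 2 * 2))"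
    using order_divides_expdiff[OF \<open>coprime p g\<close>] by (simp only: \<open>ord p g = _\<close>)
  also have "\<dots> \<longleftrightarrow> [k = l] (mod ((p - 1) div 2))"
    by (simp only: cong_def mod_mult_mult2) simp
  finally show ?thesis .
qed

lemma bij_betw_R_primroot_power:
  assumes "prime p" "odd p" "residue_primroot p g"
  shows "bij_betw (\<lambda>k. R (int g ^ k) p) {..<(p - 1) div 2} {1..(p - 1) div 2}"
proof -
  have "inj_on (\<lambda>k. R (int g ^ k) p) {..<(p - 1) div 2}"
    using R_primroot_power_eq_iff[OF assms] by (auto intro!: inj_onI simp: cong_def)
  moreover have "R (int g ^ k) p \<noteq> 0" for k
  proof -
    have "coprime p (g ^ k)"
      using assms(3) by (simp add: residue_primroot_def)
    then have "\<not> p dvd g ^ k"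
      using \<open>prime p\<close> by (metis coprime_absorb_left not_prime_unit)
    then show ?thesis
      using \<open>odd p\<close> by (simp add: R_eq_0_iff flip: of_nat_power)
  qed
  then have "(\<lambda>k. R (int g ^ k) p) ` {..<(p - 1) div 2} \<subseteq> {1..(p - 1) div 2}"
    using R_le[OF \<open>odd p\<close>] by (auto simp: Suc_le_eq)
  ultimately show ?thesis
    by (simp add: bij_betw_def card_image card_subset_eq)
qed

lemma inversion_sign_R_power:
  assumes "prime p" "odd p" "coprime a ((p - 1) div 2)"
  shows "inversion_sign (\<lambda>i. R (int i ^ a) p) {1..(p - 1) div 2} =
    inversion_sign (\<lambda>k. a * k mod ((p - 1) div 2)) {..<(p - 1) div 2}"
proof -
  obtain g where g: "residue_primroot p g"
    using prime_primitive_root_exists[of p] \<open>prime p\<close> prime_gt_1_nat by blast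
  have "R (int (R (int g ^ k) p) ^ a) p = R (int g ^ (a * k mod ((p - 1) div 2))) p" for k
  proof -
    have "R (int (R (int g ^ k) p) ^ a) p = R (int g ^ (a * k)) p"
      using \<open>odd p\<close> by (simp add: R_power_R mult.commute flip: power_mult)
    also have "\<dots> = R (int g ^ (a * k mod ((p - 1) div 2))) p"
      using assms g by (simp add: R_primroot_power_eq_iff cong_def)
    finally show ?thesis .
  qed
  then show ?thesis
    using bij_betw_R_primroot_power[OF \<open>prime p\<close> \<open>odd p\<close> g] bij_betw_mult_mod[OF assms(3)]
    by (intro inversion_sign_conj) auto
qed

lemma N_eq_card_inversions:
  "N p = card (inversions (\<lambda>i. R (int i ^ 2) p) {1..(p - 1) div 2})"
  unfolding N_def inversions_def increasing_pairs_def by (rule arg_cong[where f = card]) auto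

theorem theorem1p5:
  fixes p :: nat
  assumes "prime p" and "[p = 3] (mod 4)"
  shows "[int (N p) = \<lfloor>(real p + 1) / 8\<rfloor>] (mod 2)"
proof -
  define m where "m = p div 4"
  have p: "p = 4 * m + 3"
    using assms(2) unfolding m_def cong_def by presburger
  then have "odd p" and half: "(p - 1) div 2 = 2 * m + 1"
    by auto
  have "inversion_sign (\<lambda>i. R (int i ^ 2) p) {1..(p - 1) div 2} =
      inversion_sign (\<lambda>k. 2 * k mod (2 * m + 1)) {..<2 * m + 1}"
    using inversion_sign_R_power[of p 2] \<open>prime p\<close> \<open>odd p\<close> unfolding half by simp
  then have "even (N p) \<longleftrightarrow> even (m * (m + 1) div 2)"
    by (simp only: inversion_sign_eq_iff N_eq_card_inversions card_inversions_double_mod_odd)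
  then have even_N: "even (N p) \<longleftrightarrow> even ((m + 1) div 2)"
    by (simp only: even_triangular_iff)
  have "(real p + 1) / 8 = real (m + 1) / real 2"
    by (simp add: p)
  then have "\<lfloor>(real p + 1) / 8\<rfloor> = int ((m + 1) div 2)"
    by (simp only: floor_divide_of_nat_eq)
  with even_N show ?thesis
    by (simp add: cong_def) presburger
qed

end
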